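(* Let $k\ge 3$ be an integer and put $$p=1-\frac1k,\qquad \lambda=\frac{1}{10}-\frac{1}{2k}+\frac{1}{k^2}-\frac{1}{k^3}+\frac{2}{5k^4}.$$ Then $d_{C_5}(p)=\lambda$.
   Context: All graphs are finite and simple. For graphs $G$ and $H$, $\nu_H(G)$ denotes the number of (not necessarily induced) copies of $H$ in $G$, i.e. the number of subgraphs of $G$ isomorphic to $H$, and $d_H(G)=\nu_H(G)/|V(G)|^{|V(H)|}$. $C_5$ is the cycle on $5$ vertices. For $p\in[0,1]$, $d_{C_5}(p)=\lim_{n\to\infty}\min_G d_{C_5}(G)$, where the minimum is over all graphs $G$ of order $n$ with $(p+o(1))\binom n2$ edges (the limit exists); equivalently, $d_{C_5}(p)$ is the infimum of $\liminf_{n\to\infty} d_{C_5}(G_n)$ over all sequences of graphs $G_n$ with $|V(G_n)|\to\infty$ and $|E(G_n)|/\binom{|V(G_n)|}{2}\to p$. *)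

theory Defs
  imports Complex_Main "HOL-Library.Extended_Real" "HOL-Library.Liminf_Limsup"
begin

type_synonym 'a ugraph = "'a set \<times> 'a set set"

abbreviation verts :: "'a ugraph \<Rightarrow> 'a set" where
  "verts G \<equiv> fst G"

abbreviation edges :: "'a ugraph \<Rightarrow> 'a set set" where
  "edges G \<equiv> snd G"

definition simple_graph :: "'a ugraph \<Rightarrow> bool" where
  "simple_graph G \<longleftrightarrow> finite (verts G) \<and> (\<forall>e\<in>edges G. e \<subseteq> verts G \<and> card e = 2)"

definition subgraph :: "'a ugraph \<Rightarrow> 'a ugraph \<Rightarrow> bool" where
  "subgraph S G \<longleftrightarrow> simple_graph S \<and> verts S \<subseteq> verts G \<and> edges S \<subseteq> edges G"

definition graph_iso :: "'a ugraph \<Rightarrow> 'b ugraph \<Rightarrow> bool" where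
  "graph_iso G H \<longleftrightarrow>
    (\<exists>f. bij_betw f (verts G) (verts H) \<and>
         (\<forall>u\<in>verts G. \<forall>v\<in>verts G. {u, v} \<in> edges G \<longleftrightarrow> {f u, f v} \<in> edges H))"

definition copies :: "'b ugraph \<Rightarrow> 'a ugraph \<Rightarrow> nat" where
  "copies H G = card {S. subgraph S G \<and> graph_iso S H}"

definition copy_density :: "'b ugraph \<Rightarrow> 'a ugraph \<Rightarrow> real" where
  "copy_density H G = real (copies H G) / real (card (verts G)) ^ card (verts H)"

definition cycle_graph :: "nat \<Rightarrow> nat ugraph" where
  "cycle_graph n = ({..<n}, {{i, (i + 1) mod n} | i. i < n})"

definition edge_density :: "'a ugraph \<Rightarrow> real" where
  "edge_density G = real (card (edges G)) / real (card (verts G) choose 2)"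

text \<open>Every finite graph has an isomorphic copy whose vertices are natural numbers, so it
  suffices to let the sequences range over such graphs.  The infimum is taken in the extended
  reals, so that it is meaningful without any boundedness or nonemptiness side condition.\<close>

definition min_copy_density :: "'b ugraph \<Rightarrow> real \<Rightarrow> ereal" where
  "min_copy_density H p =
    Inf {liminf (\<lambda>n. ereal (copy_density H (G n))) | G :: nat \<Rightarrow> nat ugraph.
           (\<forall>n. simple_graph (G n)) \<and>
           filterlim (\<lambda>n. card (verts (G n))) at_top sequentially \<and>
           (\<lambda>n. edge_density (G n)) \<longlonglongrightarrow> p}"

end

theory Submission
  imports Defs
begin

text \<open>
  Let \<open>B = J - W\<close> be the complement, with loops, of the adjacency matrix \<open>W\<close> of a graph on \<open>N\<close> vertices,
  put \<open>b\<^sub>i = 1\<^sup>T B\<^sup>i 1 / N\<^bsup>i+1\<^esup>\<close> and \<open>b = b\<^sub>1\<close>.  Expanding the trace of \<open>(J - B)\<^sup>5\<close> over cyclic words gives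
  the homomorphism density of the 5-cycle as
  \<open>1 - 5 b + 5 b\<^sub>2 + 5 b\<^sup>2 - 5 b\<^sub>3 - 5 b b\<^sub>2 + 5 b\<^sub>4 - tr B\<^sup>5 / N\<^sup>5\<close>.
  Dropping one factor of each closed walk bounds \<open>tr B\<^sup>5 / N\<^sup>5\<close> by \<open>b\<^sub>4\<close>, and the remaining expression
  \<open>4 b\<^sub>4 - 5 b\<^sub>3 + 5 (1 - b) b\<^sub>2\<close> is the mean, over the spectral measure of the all-ones vector, of
  a polynomial lying above its tangent at \<open>b\<close>, so it is smallest when all degrees agree.  This yields the lower bound \<open>1 - 5 b + 10 b\<^sup>2 - 10 b\<^sup>3 + 4 b\<^sup>4\<close>.  For balanced complete
  \<open>k\<close>-partite graphs \<open>B\<close> is a regular equivalence relation and every step is an equality with \<open>b = 1/k\<close>.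
  Each 5-cycle has ten labellings and only \<open>O(N\<^sup>4)\<close> closed walks are not injective.
\<close>

section \<open>Closed walks in the complement of a symmetric kernel\<close>

locale symmetric_kernel =
  fixes V :: "'a set" and B :: "'a \<Rightarrow> 'a \<Rightarrow> real"
  assumes sym: "B x y = B y x"
begin

section \<open>Row sums, walk counts and powers of the kernel\<close>

definition N :: real where "N = real (card V)"
definition deg :: "'a \<Rightarrow> real" where "deg x = (\<Sum>y\<in>V. B x y)"
text \<open>Row sums of the matrix \<open>B^2\<close>. By symmetry a walk may be cut at an inner
  vertex, so \<open>walks3\<close> and \<open>walks4\<close> below are the entry sums of
  \<open>B^3\<close> and \<open>B^4\<close>, while \<open>closed5\<close> is the trace of
  \<open>B^5\<close>.\<close>

definition wdeg :: "'a \<Rightarrow> real" where "wdeg x = (\<Sum>y\<in>V. B x y * deg y)"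
definition B2 :: "'a \<Rightarrow> 'a \<Rightarrow> real" where "B2 x y = (\<Sum>z\<in>V. B x z * B z y)"
definition B3 :: "'a \<Rightarrow> 'a \<Rightarrow> real" where "B3 x y = (\<Sum>z\<in>V. B2 x z * B z y)"
definition walks1 :: real where "walks1 = (\<Sum>x\<in>V. deg x)"
definition walks2 :: real where "walks2 = (\<Sum>x\<in>V. (deg x)\<^sup>2)"
definition walks3 :: real where "walks3 = (\<Sum>x\<in>V. deg x * wdeg x)"
definition walks4 :: real where "walks4 = (\<Sum>x\<in>V. (wdeg x)\<^sup>2)"
definition closed5 :: real where "closed5 = (\<Sum>x\<in>V. \<Sum>y\<in>V. B2 x y * B3 y x)"

lemma sum_B_left: "(\<Sum>x\<in>V. B x y) = deg y"
  by (simp add: deg_def sym[of _ y])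

lemma B2_sym: "B2 x y = B2 y x"
  by (simp add: B2_def sym mult.commute)

lemma sum_weighted_B_left: "(\<Sum>x\<in>V. deg x * B x y) = wdeg y"
  unfolding wdeg_def by (rule sum.cong) (simp_all add: sym[of _ y] mult.commute)

lemma sum_B2_right: "(\<Sum>y\<in>V. B2 x y) = wdeg x"
  unfolding B2_def wdeg_def deg_def by (subst sum.swap) (simp add: sum_distrib_left)

lemma sum_weighted_B2_right: "(\<Sum>y\<in>V. B2 x y * deg y) = (\<Sum>y\<in>V. B x y * wdeg y)"
  unfolding B2_def wdeg_def sum_distrib_right sum_distrib_left
  by (subst sum.swap) (simp add: mult.assoc)

lemma sum_B2_left: "(\<Sum>x\<in>V. B2 x y) = wdeg y"
  using sum_B2_right by (simp add: B2_sym[of _ y])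

lemma sum_B3_left: "(\<Sum>x\<in>V. B3 x y) = (\<Sum>z\<in>V. B y z * wdeg z)"
  unfolding B3_def sym[of y] mult.commute[of "B _ y" "wdeg _"]
  by (subst sum.swap) (simp add: sum_distrib_right[symmetric] sum_B2_left)

lemma sum_B3_right: "(\<Sum>y\<in>V. B3 x y) = (\<Sum>z\<in>V. B x z * wdeg z)"
proof -
  have "(\<Sum>y\<in>V. B3 x y) = (\<Sum>z\<in>V. B2 x z * deg z)"
    unfolding B3_def by (subst sum.swap) (simp add: sum_distrib_left[symmetric] deg_def)
  then show ?thesis by (simp add: sum_weighted_B2_right)
qed

lemma sum_wdeg: "(\<Sum>x\<in>V. wdeg x) = walks2"
  unfolding wdeg_def walks2_def
  by (subst sum.swap) (simp add: sum_distrib_right[symmetric] sum_B_left power2_eq_square)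

lemma sum_B_wdeg: "(\<Sum>x\<in>V. \<Sum>y\<in>V. B x y * wdeg y) = walks3"
  unfolding walks3_def by (subst sum.swap) (simp add: sum_distrib_right[symmetric] sum_B_left)

lemma sum_deg_B_wdeg: "(\<Sum>x\<in>V. deg x * (\<Sum>y\<in>V. B x y * wdeg y)) = walks4"
  unfolding walks4_def sum_distrib_left
  by (subst sum.swap)
     (simp add: sum_distrib_right[symmetric] mult.assoc[symmetric] sum_weighted_B_left power2_eq_square)

section \<open>The trace of the fifth power of the complementary kernel\<close>

text \<open>An entry of \<open>(J - B)^2\<close>, one term for each of the words \<open>JJ\<close>,
  \<open>BJ\<close>, \<open>JB\<close>, \<open>BB\<close>.\<close>

lemma complement_two_walks:
  "(\<Sum>z\<in>V. (1 - B x z) * (1 - B z y)) = N - deg x - deg y + B2 x y"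
  by (simp add: algebra_simps sum.distrib sum_subtractf B2_def N_def deg_def sum_B_left sym[of _ y])

text \<open>An entry of \<open>(J - B)^3\<close>, with the square already expanded; the eight terms
  are the eight words of length three in \<open>J\<close> and \<open>B\<close>. The word
  \<open>JBJ\<close> gives \<open>walks1\<close>, and \<open>BJB\<close> gives
  \<open>deg x * deg y\<close>.\<close>

lemma complement_three_walks:
  "(\<Sum>z\<in>V. (N - deg x - deg z + B2 x z) * (1 - B z y)) =
    N\<^sup>2 - walks1 - N * deg x - N * deg y + wdeg x + wdeg y + deg x * deg y - B3 x y"
proof -
  have "(\<Sum>z\<in>V. (N - deg x - deg z + B2 x z) * (1 - B z y)) =
    (\<Sum>z\<in>V. N - deg x) - (\<Sum>z\<in>V. deg z) + (\<Sum>z\<in>V. B2 x z)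
     - (N - deg x) * (\<Sum>z\<in>V. B z y) + (\<Sum>z\<in>V. deg z * B z y) - (\<Sum>z\<in>V. B2 x z * B z y)"
    by (simp add: algebra_simps sum.distrib sum_subtractf sum_distrib_left)
  also have "\<dots> = N * (N - deg x) - walks1 + wdeg x - (N - deg x) * deg y + wdeg y - B3 x y"
    by (simp add: sum_B2_right sum_B_left sum_weighted_B_left B3_def walks1_def N_def)
  finally show ?thesis by (simp add: algebra_simps power2_eq_square)
qed

text \<open>The trace of \<open>(J - B)^5\<close>, grouped as a square times a cube so that the two
  preceding expansions apply.\<close>

definition complement_closed5 :: real where
  "complement_closed5 = (\<Sum>x\<in>V. \<Sum>y\<in>V. (\<Sum>z\<in>V. (1 - B x z) * (1 - B z y)) *
     (\<Sum>w\<in>V. (\<Sum>z\<in>V. (1 - B y z) * (1 - B z w)) * (1 - B w x)))"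

text \<open>Each \<open>J\<close> in a cyclic word cuts it into open walks, so the word contributes
  a product of walk counts. As 5 is prime, every non-constant word has five distinct rotations,
  whence the coefficients 5; the signs count the factors \<open>B\<close>.\<close>

lemma complement_closed5_expand:
  "complement_closed5 = N ^ 5 - 5 * N ^ 3 * walks1 + 5 * N\<^sup>2 * walks2 + 5 * N * walks1\<^sup>2
     - 5 * N * walks3 - 5 * walks1 * walks2 + 5 * walks4 - closed5"
proof -
  \<comment> \<open>The part of the cube's entry at \<open>(y, x)\<close> that comes from words
    containing a \<open>J\<close>.\<close>
  define g where "g x y = N\<^sup>2 - walks1 - N * deg y - N * deg x + wdeg y + wdeg x + deg y * deg x"
    for x y
  have inner: "(\<Sum>y\<in>V. (N - deg x - deg y + B2 x y) * (g x y - B3 y x)) =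
      (N - deg x) * (N * (N\<^sup>2 - walks1 - N * deg x + wdeg x) + (deg x - N) * walks1 + walks2)
      - ((N\<^sup>2 - walks1 - N * deg x + wdeg x) * walks1 + (deg x - N) * walks2 + walks3)
      + ((N\<^sup>2 - walks1 - N * deg x + wdeg x) * wdeg x + (deg x - N) * (\<Sum>y\<in>V. B x y * wdeg y)
          + (\<Sum>y\<in>V. B2 x y * wdeg y))
      - (N - deg x) * (\<Sum>y\<in>V. B x y * wdeg y) + (\<Sum>y\<in>V. deg y * B3 y x)
      - (\<Sum>y\<in>V. B2 x y * B3 y x)" for x
  proof -
    \<comment> \<open>The terms of \<open>g x y\<close> that are free of \<open>y\<close>; what
      remains is \<open>(deg x - N) * deg y + wdeg y\<close>.\<close>
    define c where "c = N\<^sup>2 - walks1 - N * deg x + wdeg x"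
    have "(\<Sum>y\<in>V. (N - deg x - deg y + B2 x y) * (g x y - B3 y x)) =
      (\<Sum>y\<in>V. (N - deg x) * c + (N - deg x) * (deg x - N) * deg y + (N - deg x) * wdeg y
       - c * deg y - (deg x - N) * (deg y)\<^sup>2 - deg y * wdeg y
       + c * B2 x y + (deg x - N) * (B2 x y * deg y) + B2 x y * wdeg y
       - (N - deg x) * B3 y x + deg y * B3 y x - B2 x y * B3 y x)"
      by (rule sum.cong) (simp_all add: g_def c_def algebra_simps power2_eq_square)
    also have "\<dots> = N * ((N - deg x) * c) + (N - deg x) * (deg x - N) * walks1 + (N - deg x) * walks2
       - c * walks1 - (deg x - N) * walks2 - walks3
       + c * wdeg x + (deg x - N) * (\<Sum>y\<in>V. B x y * wdeg y) + (\<Sum>y\<in>V. B2 x y * wdeg y)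
       - (N - deg x) * (\<Sum>y\<in>V. B x y * wdeg y) + (\<Sum>y\<in>V. deg y * B3 y x)
       - (\<Sum>y\<in>V. B2 x y * B3 y x)"
      unfolding sum.distrib sum_subtractf sum_distrib_left[symmetric]
      by (simp add: sum_wdeg sum_B2_right sum_weighted_B2_right sum_B3_left N_def
          walks1_def walks2_def walks3_def)
    finally show ?thesis unfolding c_def by (simp add: algebra_simps)
  qed
  have deg_B3: "(\<Sum>x\<in>V. \<Sum>y\<in>V. deg y * B3 y x) = walks4"
    by (subst sum.swap) (simp add: sum_distrib_left[symmetric] sum_B3_right sum_deg_B_wdeg)
  have B2_wdeg: "(\<Sum>x\<in>V. \<Sum>y\<in>V. B2 x y * wdeg y) = walks4"
    by (subst sum.swap) (simp add: sum_distrib_right[symmetric] sum_B2_left walks4_def power2_eq_square)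
  have "complement_closed5 = (\<Sum>x\<in>V. \<Sum>y\<in>V. (N - deg x - deg y + B2 x y) * (g x y - B3 y x))"
    unfolding complement_closed5_def complement_two_walks complement_three_walks g_def ..
  also have "\<dots> = (\<Sum>x\<in>V. N * N * (N\<^sup>2 - walks1) - N * N * walks1 + N * walks2
      - (N\<^sup>2 - walks1) * walks1 + N * walks2 - walks3
      + (- N * N * N - N * (N\<^sup>2 - walks1) + N * walks1 + N * walks1 - walks2 + N * walks1 - walks2) * deg x
      + (N * N - walks1) * (deg x)\<^sup>2
      - walks1 * (deg x)\<^sup>2 + walks1 * (deg x)\<^sup>2
      + (N * N - walks1 + N\<^sup>2 - walks1) * wdeg x
      - (N + N) * (deg x * wdeg x) + (wdeg x)\<^sup>2
      - (N + N) * (\<Sum>y\<in>V. B x y * wdeg y) + 2 * (deg x * (\<Sum>y\<in>V. B x y * wdeg y))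
      + (\<Sum>y\<in>V. B2 x y * wdeg y) + (\<Sum>y\<in>V. deg y * B3 y x) - (\<Sum>y\<in>V. B2 x y * B3 y x))"
    unfolding inner by (rule sum.cong[OF refl]) algebra
  also have "\<dots> = N * (N * N * (N\<^sup>2 - walks1) - N * N * walks1 + N * walks2
      - (N\<^sup>2 - walks1) * walks1 + N * walks2 - walks3)
      + (- N * N * N - N * (N\<^sup>2 - walks1) + N * walks1 + N * walks1 - walks2 + N * walks1 - walks2) * walks1
      + (N * N - walks1) * walks2 - walks1 * walks2 + walks1 * walks2
      + (N * N - walks1 + N\<^sup>2 - walks1) * walks2
      - (N + N) * walks3 + walks4 - (N + N) * walks3 + 2 * walks4 + walks4 + walks4 - closed5"
    unfolding sum.distrib sum_subtractf sum_distrib_left[symmetric] sum_wdeg sum_B_wdeg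
      sum_deg_B_wdeg deg_B3 B2_wdeg
    unfolding closed5_def walks1_def[symmetric] walks2_def[symmetric] walks3_def[symmetric]
      walks4_def[symmetric] sum_constant N_def[symmetric]
    by algebra
  also have "\<dots> = N ^ 5 - 5 * N ^ 3 * walks1 + 5 * N\<^sup>2 * walks2 + 5 * N * walks1\<^sup>2
     - 5 * N * walks3 - 5 * walks1 * walks2 + 5 * walks4 - closed5"
    by algebra
  finally show ?thesis .
qed

section \<open>The lower bound and the case of equality\<close>

lemma closed5_le_walks4:
  assumes "\<And>x y. 0 \<le> B x y" "\<And>x y. B x y \<le> 1"
  shows "closed5 \<le> walks4"
proof -
  have B2_nonneg: "0 \<le> B2 x y" for x y
    unfolding B2_def using assms by (simp add: sum_nonneg)
  have "B3 y x \<le> wdeg y" for x y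
    unfolding B3_def sum_B2_right[symmetric]
    by (intro sum_mono mult_left_le B2_nonneg assms)
  then have "closed5 \<le> (\<Sum>x\<in>V. \<Sum>y\<in>V. B2 x y * wdeg y)"
    unfolding closed5_def by (intro sum_mono mult_left_mono B2_nonneg)
  also have "\<dots> = walks4"
    by (subst sum.swap) (simp add: sum_distrib_right[symmetric] sum_B2_left walks4_def power2_eq_square)
  finally show ?thesis .
qed

text \<open>The excess over the value for constant degrees is the quadratic form of
  \<open>4 t\<^sup>2 + (8 b - 5) t + (12 b\<^sup>2 - 15 b + 5)\<close> at \<open>t = B / N\<close> in the vector of degree deviations, where \<open>b\<close>
  is the density of \<open>B\<close>; completing the square shows that this polynomial is positive for every \<open>b\<close>.\<close>

lemma walks_convexity:
  assumes "N > 0" and b: "b = walks1 / N\<^sup>2"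
  shows "4 * walks4 - 5 * N * walks3 + 5 * (1 - b) * N\<^sup>2 * walks2
     \<ge> (4 * b ^ 4 - 10 * b ^ 3 + 5 * b\<^sup>2) * N ^ 5"
proof -
  have w1: "walks1 = b * N\<^sup>2" using assms by simp
  have w2: "(\<Sum>x\<in>V. (deg x - b * N)\<^sup>2) = walks2 - b\<^sup>2 * N ^ 3"
  proof -
    have "(\<Sum>x\<in>V. (deg x - b * N)\<^sup>2) = (\<Sum>x\<in>V. (deg x)\<^sup>2 - 2 * b * N * deg x + b\<^sup>2 * N\<^sup>2)"
      by (rule sum.cong[OF refl]) algebra
    also have "\<dots> = walks2 - 2 * b * N * walks1 + N * (b\<^sup>2 * N\<^sup>2)"
      unfolding sum.distrib sum_subtractf sum_distrib_left[symmetric]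
      by (simp add: walks2_def walks1_def N_def)
    finally show ?thesis unfolding w1 by algebra
  qed
  \<comment> \<open>The deviation vector \<open>deg - b * N\<close> under the matrix
    \<open>2 * B + (8 * b - 5) / 4 * N\<close>, the linear form whose square absorbs the quadratic
    and linear terms of the polynomial.\<close>
  define u where "u x = 2 * (wdeg x - b * N * deg x) + (8 * b - 5) / 4 * N * (deg x - b * N)" for x
  have "(\<Sum>x\<in>V. (u x)\<^sup>2) = (\<Sum>x\<in>V. 4 * (wdeg x)\<^sup>2 - 5 * N * (deg x * wdeg x)
      + ((5/4)\<^sup>2 * N\<^sup>2) * (deg x)\<^sup>2
      + (5/2) * ((8 * b - 5) / 4 * b * N ^ 3) * deg x
      - (8 * b - 5) * b * N\<^sup>2 * wdeg x + ((8 * b - 5) / 4)\<^sup>2 * b\<^sup>2 * N ^ 4)"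
    by (rule sum.cong[OF refl]) (simp add: u_def field_simps power2_eq_square power3_eq_cube power4_eq_xxxx)
  also have "\<dots> = 4 * walks4 - 5 * N * walks3 + ((5/4)\<^sup>2 * N\<^sup>2) * walks2
      + (5/2) * ((8 * b - 5) / 4 * b * N ^ 3) * walks1
      - (8 * b - 5) * b * N\<^sup>2 * walks2 + N * (((8 * b - 5) / 4)\<^sup>2 * b\<^sup>2 * N ^ 4)"
    unfolding sum.distrib sum_subtractf sum_distrib_left[symmetric] sum_wdeg
    by (simp add: walks2_def walks1_def walks3_def walks4_def N_def)
  finally have u: "(\<Sum>x\<in>V. (u x)\<^sup>2) = \<dots>" .
  have pos: "0 \<le> 12 * b\<^sup>2 - 15 * b + 5 - ((8 * b - 5) / 4)\<^sup>2"
  proof -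
    have "12 * b\<^sup>2 - 15 * b + 5 - ((8 * b - 5) / 4)\<^sup>2 = 8 * (b - 5 / 8)\<^sup>2 + 5 / 16"
      by (simp add: field_simps power2_eq_square)
    then show ?thesis by simp
  qed
  have "0 \<le> (\<Sum>x\<in>V. (u x)\<^sup>2) + (12 * b\<^sup>2 - 15 * b + 5 - ((8 * b - 5) / 4)\<^sup>2) * N\<^sup>2 *
      (\<Sum>x\<in>V. (deg x - b * N)\<^sup>2)"
    using pos by (intro add_nonneg_nonneg mult_nonneg_nonneg sum_nonneg) simp_all
  also have "\<dots> = 4 * walks4 - 5 * N * walks3 + 5 * (1 - b) * N\<^sup>2 * walks2
     - (4 * b ^ 4 - 10 * b ^ 3 + 5 * b\<^sup>2) * N ^ 5"
    unfolding u w2 w1 by (simp add: field_simps power2_eq_square eval_nat_numeral)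
  finally show ?thesis by simp
qed

text \<open>After \<open>closed5\<close> is replaced by \<open>walks4\<close> and
  \<open>walks1\<close> by \<open>b * N^2\<close>, what is left beyond a polynomial in
  \<open>b\<close> is exactly the expression bounded in \<open>walks_convexity\<close>.\<close>

lemma complement_closed5_ge:
  assumes "\<And>x y. 0 \<le> B x y" "\<And>x y. B x y \<le> 1" and "N > 0" and b: "b = walks1 / N\<^sup>2"
  shows "complement_closed5 \<ge> (1 - 5 * b + 10 * b\<^sup>2 - 10 * b ^ 3 + 4 * b ^ 4) * N ^ 5"
proof -
  have w1: "walks1 = b * N\<^sup>2" using assms by simp
  have "complement_closed5 \<ge> N ^ 5 - 5 * N ^ 3 * walks1 + 5 * N\<^sup>2 * walks2 + 5 * N * walks1\<^sup>2
     - 5 * N * walks3 - 5 * walks1 * walks2 + 4 * walks4"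
    unfolding complement_closed5_expand using closed5_le_walks4[OF assms(1,2)] by simp
  moreover have "N ^ 5 - 5 * N ^ 3 * walks1 + 5 * N\<^sup>2 * walks2 + 5 * N * walks1\<^sup>2
     - 5 * N * walks3 - 5 * walks1 * walks2 + 4 * walks4
     = (1 - 5 * b + 5 * b\<^sup>2) * N ^ 5 +
       (4 * walks4 - 5 * N * walks3 + 5 * (1 - b) * N\<^sup>2 * walks2)"
    unfolding w1 by algebra
  moreover note walks_convexity[OF assms(3) b]
  moreover have "(1 - 5 * b + 10 * b\<^sup>2 - 10 * b ^ 3 + 4 * b ^ 4) * N ^ 5 =
      (1 - 5 * b + 5 * b\<^sup>2) * N ^ 5 + (4 * b ^ 4 - 10 * b ^ 3 + 5 * b\<^sup>2) * N ^ 5"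
    by algebra
  ultimately show ?thesis by linarith
qed

text \<open>With \<open>B^2 = D * B\<close> on \<open>V\<close>, all powers of \<open>B\<close> are
  multiples of \<open>B\<close>. Since the entries are 0 or 1, the sum of their squares is the sum
  of the degrees, so \<open>closed5\<close> equals \<open>walks4\<close> here.\<close>

lemma complement_closed5_regular:
  assumes deg: "\<And>x. x \<in> V \<Longrightarrow> deg x = D"
    and B2: "\<And>x y. x \<in> V \<Longrightarrow> y \<in> V \<Longrightarrow> B2 x y = D * B x y"
    and idem: "\<And>x y. B x y * B x y = B x y"
  shows "complement_closed5 = N ^ 5 - 5 * N ^ 4 * D + 10 * N ^ 3 * D\<^sup>2 - 10 * N\<^sup>2 * D ^ 3 + 4 * N * D ^ 4"
proof -
  have wdeg: "wdeg x = D\<^sup>2" if "x \<in> V" for x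
  proof -
    have "wdeg x = (\<Sum>y\<in>V. B x y * D)"
      unfolding wdeg_def using deg by simp
    then show ?thesis
      using deg[OF that] by (simp add: sum_distrib_right[symmetric] deg_def[symmetric] power2_eq_square)
  qed
  have B3: "B3 x y = D\<^sup>2 * B x y" if "x \<in> V" "y \<in> V" for x y
  proof -
    have "B3 x y = (\<Sum>z\<in>V. D * (B x z * B z y))"
      unfolding B3_def using B2 that by (simp add: mult.assoc)
    also have "\<dots> = D * B2 x y"
      unfolding B2_def by (simp add: sum_distrib_left)
    finally show ?thesis using B2[OF that] by (simp add: power2_eq_square)
  qed
  have "closed5 = (\<Sum>x\<in>V. \<Sum>y\<in>V. D ^ 3 * B x y)"
    unfolding closed5_def
  proof (intro sum.cong refl)
    fix x y assume "x \<in> V" "y \<in> V"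
    then have "B2 x y * B3 y x = D ^ 3 * (B x y * B x y)"
      by (simp add: B2 B3 sym[of y x] power2_eq_square power3_eq_cube)
    then show "B2 x y * B3 y x = D ^ 3 * B x y" by (simp only: idem)
  qed
  also have "\<dots> = D ^ 3 * (\<Sum>x\<in>V. deg x)"
    by (simp add: deg_def sum_distrib_left)
  finally have "closed5 = N * D ^ 4"
    using deg by (simp add: N_def eval_nat_numeral)
  moreover have "walks1 = N * D" "walks2 = N * D\<^sup>2" "walks3 = N * D ^ 3" "walks4 = N * D ^ 4"
    using deg wdeg by (simp_all add: walks1_def walks2_def walks3_def walks4_def N_def eval_nat_numeral)
  ultimately show ?thesis
    unfolding complement_closed5_expand by algebra
qed

end

section \<open>Labelled 5-cycles and closed walks\<close>

text \<open>These are the homomorphisms from the 5-cycle to \<open>G\<close>, written as tuples;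
  \<open>labelled_cycles5\<close> keeps the injective ones, and \<open>cycle_of\<close> forgets the
  labelling.\<close>

definition closed_walks5 :: "'a ugraph \<Rightarrow> ('a \<times> 'a \<times> 'a \<times> 'a \<times> 'a) set" where
  "closed_walks5 G = {(a, b, c, d, e). {a, b, c, d, e} \<subseteq> verts G \<and>
     {{a, b}, {b, c}, {c, d}, {d, e}, {e, a}} \<subseteq> edges G}"

definition labelled_cycles5 :: "'a ugraph \<Rightarrow> ('a \<times> 'a \<times> 'a \<times> 'a \<times> 'a) set" where
  "labelled_cycles5 G = {(a, b, c, d, e) \<in> closed_walks5 G. distinct [a, b, c, d, e]}"

definition cycle_of :: "'a \<times> 'a \<times> 'a \<times> 'a \<times> 'a \<Rightarrow> 'a ugraph" where
  "cycle_of = (\<lambda>(a, b, c, d, e). ({a, b, c, d, e}, {{a, b}, {b, c}, {c, d}, {d, e}, {e, a}}))"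

section \<open>Copies of the 5-cycle as images of labelled cycles\<close>

lemma edges_cycle_graph_5:
  "edges (cycle_graph 5) = {{0, 1}, {1, 2}, {2, 3}, {3, 4}, {4, 0}}"
proof -
  have "edges (cycle_graph 5) = (\<lambda>i. {i, (i + 1) mod 5}) ` {..<5}"
    by (auto simp: cycle_graph_def)
  also have "{..<5} = {0, 1, 2, 3, 4::nat}" by auto
  finally show ?thesis by (simp add: numeral_2_eq_2)
qed

lemma verts_cycle_graph_5: "verts (cycle_graph 5) = {0, 1, 2, 3, 4}"
  by (auto simp: cycle_graph_def)

lemma graph_iso_cycle_of:
  assumes "distinct [a, b, c, d, e]"
  shows "graph_iso (cycle_of (a, b, c, d, e)) (cycle_graph 5)"
proof -
  define f :: "'a \<Rightarrow> nat" where
    "f x = (if x = a then 0 else if x = b then 1 else if x = c then 2 else if x = d then 3 else 4)" for x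
  have f: "f a = 0" "f b = 1" "f c = 2" "f d = 3" "f e = 4"
    using assms by (auto simp: f_def)
  show ?thesis
    unfolding graph_iso_def
  proof (intro exI conjI)
    show "bij_betw f (verts (cycle_of (a, b, c, d, e))) (verts (cycle_graph 5))"
      unfolding verts_cycle_graph_5 using assms by (auto simp: bij_betw_def cycle_of_def f)
    show "\<forall>u\<in>verts (cycle_of (a, b, c, d, e)). \<forall>v\<in>verts (cycle_of (a, b, c, d, e)).
        {u, v} \<in> edges (cycle_of (a, b, c, d, e)) \<longleftrightarrow> {f u, f v} \<in> edges (cycle_graph 5)"
      using assms unfolding edges_cycle_graph_5
      by (simp add: cycle_of_def f doubleton_eq_iff) blast
  qed
qed

text \<open>The inverse of the isomorphism supplies the labelling. Isomorphism only controls edges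
  of the form \<open>{u, v}\<close> with both ends in \<open>verts S\<close>; simplicity ensures
  that all edges are of this form.\<close>

lemma simple_graph_iso_cycle5:
  assumes "simple_graph S" "graph_iso S (cycle_graph 5)"
  obtains a b c d e where "distinct [a, b, c, d, e]" "S = cycle_of (a, b, c, d, e)"
proof -
  obtain f where f: "bij_betw f (verts S) {0, 1, 2, 3, 4::nat}"
    and E: "\<And>u v. u \<in> verts S \<Longrightarrow> v \<in> verts S \<Longrightarrow>
       {u, v} \<in> edges S \<longleftrightarrow> {f u, f v} \<in> {{0, 1}, {1, 2}, {2, 3}, {3, 4}, {4, 0}}"
  proof -
    obtain f where "bij_betw f (verts S) (verts (cycle_graph 5))"
      "\<forall>u\<in>verts S. \<forall>v\<in>verts S. {u, v} \<in> edges S \<longleftrightarrow> {f u, f v} \<in> edges (cycle_graph 5)"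
      using assms(2) unfolding graph_iso_def by blast
    then show thesis
      using that unfolding edges_cycle_graph_5 verts_cycle_graph_5 by (metis (no_types))
  qed
  define g where "g = inv_into (verts S) f"
  have g: "bij_betw g {0, 1, 2, 3, 4} (verts S)"
    unfolding g_def by (rule bij_betw_inv_into[OF f])
  have fg: "f (g i) = i" if "i \<in> {0, 1, 2, 3, 4}" for i
    unfolding g_def using f that by (rule bij_betw_inv_into_right)
  have V: "verts S = {g 0, g 1, g 2, g 3, g 4}"
    using bij_betw_imp_surj_on[OF g] by simp
  have dist: "distinct [g 0, g 1, g 2, g 3, g 4]"
    using bij_betw_imp_inj_on[OF g] by (simp add: inj_on_def)
  let ?C = "{{g 0, g 1}, {g 1, g 2}, {g 2, g 3}, {g 3, g 4}, {g 4, g 0}}"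
  have f_iff: "f u = i \<longleftrightarrow> u = g i" if "u \<in> verts S" "i \<in> {0, 1, 2, 3, 4}" for u i
    using fg[OF that(2)] bij_betw_inv_into_left[OF f that(1)] unfolding g_def by metis
  have E': "{u, v} \<in> edges S \<longleftrightarrow> {u, v} \<in> ?C" if "u \<in> verts S" "v \<in> verts S" for u v
    unfolding E[OF that] by (simp only: insert_iff empty_iff doubleton_eq_iff f_iff that simp_thms)
  have "edges S = ?C"
  proof (rule set_eqI, rule iffI)
    fix x assume x: "x \<in> edges S"
    then have "x \<subseteq> verts S" "card x = 2" using assms(1) by (auto simp: simple_graph_def)
    then obtain u v where uv: "x = {u, v}" "u \<in> verts S" "v \<in> verts S"
      by (auto simp: card_2_iff)
    show "x \<in> ?C" using x unfolding uv(1) E'[OF uv(2,3)] .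
  next
    have "{g 0, g 1} \<in> edges S" "{g 1, g 2} \<in> edges S" "{g 2, g 3} \<in> edges S"
      "{g 3, g 4} \<in> edges S" "{g 4, g 0} \<in> edges S"
      by (simp_all only: E' V insert_iff simp_thms)
    moreover fix x assume "x \<in> ?C"
    ultimately show "x \<in> edges S" by (elim insertE emptyE) simp_all
  qed
  then have "S = cycle_of (g 0, g 1, g 2, g 3, g 4)"
    using V by (simp add: cycle_of_def prod_eq_iff)
  then show ?thesis using that dist by blast
qed

text \<open>Reduces the count of copies to the size of the fibres of
  \<open>cycle_of\<close>.\<close>

lemma subgraph_cycle5_image:
  assumes "simple_graph G"
  shows "{S. subgraph S G \<and> graph_iso S (cycle_graph 5)} = cycle_of ` labelled_cycles5 G"
proof (intro set_eqI iffI)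
  fix S assume "S \<in> {S. subgraph S G \<and> graph_iso S (cycle_graph 5)}"
  then have S: "subgraph S G" "graph_iso S (cycle_graph 5)" by auto
  then obtain a b c d e where *: "distinct [a, b, c, d, e]" "S = cycle_of (a, b, c, d, e)"
    using simple_graph_iso_cycle5 unfolding subgraph_def by blast
  then have "(a, b, c, d, e) \<in> labelled_cycles5 G"
    using S(1) by (simp add: subgraph_def labelled_cycles5_def closed_walks5_def cycle_of_def)
  then show "S \<in> cycle_of ` labelled_cycles5 G" using * by blast
next
  fix S assume "S \<in> cycle_of ` labelled_cycles5 G"
  then obtain a b c d e where S: "S = cycle_of (a, b, c, d, e)"
    and t: "(a, b, c, d, e) \<in> labelled_cycles5 G" by auto
  then have dist: "distinct [a, b, c, d, e]" by (simp add: labelled_cycles5_def)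
  have "simple_graph S"
    using dist by (auto simp: S simple_graph_def cycle_of_def)
  then have "subgraph S G"
    using t by (simp add: S subgraph_def labelled_cycles5_def closed_walks5_def cycle_of_def)
  then show "S \<in> {S. subgraph S G \<and> graph_iso S (cycle_graph 5)}"
    using graph_iso_cycle_of[OF dist] S by simp
qed

section \<open>The ten labellings of a 5-cycle\<close>

text \<open>Once the first directed edge is fixed, the walk cannot turn back: each next vertex is
  the other neighbour of the current one on the cycle.\<close>

lemma cycle_labelling_determined:
  assumes "distinct [a, b, c, d, e]" "distinct [a, b, c', d', e']"
    and E: "{{a, b}, {b, c'}, {c', d'}, {d', e'}, {e', a}} \<subseteq> {{a, b}, {b, c}, {c, d}, {d, e}, {e, a}}"
  shows "c' = c \<and> d' = d \<and> e' = e"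
proof -
  have "c' = c"
    using assms by (auto simp: doubleton_eq_iff)
  moreover from this have "d' = d"
    using assms by (auto simp: doubleton_eq_iff)
  ultimately show ?thesis
    using assms by (auto simp: doubleton_eq_iff)
qed

text \<open>The fibre is an orbit of the dihedral group: the first step of a labelling is one of
  five edges in one of two directions, and it determines the rest.\<close>

lemma cycle_of_fibre:
  assumes "(a, b, c, d, e) \<in> labelled_cycles5 G"
  shows "{t \<in> labelled_cycles5 G. cycle_of t = cycle_of (a, b, c, d, e)} =
    {(a, b, c, d, e), (b, c, d, e, a), (c, d, e, a, b), (d, e, a, b, c), (e, a, b, c, d),
     (e, d, c, b, a), (d, c, b, a, e), (c, b, a, e, d), (b, a, e, d, c), (a, e, d, c, b)}"
    (is "?L = ?R")
proof
  have dist: "a \<noteq> b" "a \<noteq> c" "a \<noteq> d" "a \<noteq> e" "b \<noteq> c" "b \<noteq> d" "b \<noteq> e" "c \<noteq> d" "c \<noteq> e" "d \<noteq> e"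
    using assms by (auto simp: labelled_cycles5_def)
  let ?E = "{{a, b}, {b, c}, {c, d}, {d, e}, {e, a}}"
  show "?L \<subseteq> ?R"
  proof
    fix t assume "t \<in> ?L"
    moreover obtain a' b' c' d' e' where t: "t = (a', b', c', d', e')" by (cases t)
    ultimately have d': "distinct [a', b', c', d', e']"
      and E: "{{a', b'}, {b', c'}, {c', d'}, {d', e'}, {e', a'}} = ?E"
      unfolding t by (simp_all add: labelled_cycles5_def cycle_of_def)
    have "{a', b'} \<in> ?E"
      unfolding E[symmetric] by (rule insertI1)
    then have ab: "(a', b') \<in> {(a, b), (b, c), (c, d), (d, e), (e, a), (b, a), (c, b), (d, c), (e, d), (a, e)}"
      by (auto simp: doubleton_eq_iff)
    have determined: "t = (x, y, z, u, v)"
      if "(a', b') = (x, y)" "?E = {{x, y}, {y, z}, {z, u}, {u, v}, {v, x}}" "distinct [x, y, z, u, v]"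
      for x y z u v
    proof -
      have xy: "a' = x" "b' = y" using that(1) by simp_all
      show ?thesis
        using cycle_labelling_determined[OF that(3) d'[unfolded xy] E[unfolded xy that(2), THEN equalityD1]]
        by (simp add: t xy)
    qed
    \<comment> \<open>One way of writing the edge set for each first directed edge in
      \<open>ab\<close>. Matching against this list instantiates the three remaining vertices in
      \<open>determined\<close>.\<close>
    have rotations: "?E = ?E" "?E = {{b, c}, {c, d}, {d, e}, {e, a}, {a, b}}"
      "?E = {{c, d}, {d, e}, {e, a}, {a, b}, {b, c}}"
      "?E = {{d, e}, {e, a}, {a, b}, {b, c}, {c, d}}"
      "?E = {{e, a}, {a, b}, {b, c}, {c, d}, {d, e}}"
      "?E = {{b, a}, {a, e}, {e, d}, {d, c}, {c, b}}"
      "?E = {{c, b}, {b, a}, {a, e}, {e, d}, {d, c}}"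
      "?E = {{d, c}, {c, b}, {b, a}, {a, e}, {e, d}}"
      "?E = {{e, d}, {d, c}, {c, b}, {b, a}, {a, e}}"
      "?E = {{a, e}, {e, d}, {d, c}, {c, b}, {b, a}}"
      by (simp_all only: insert_commute)
    show "t \<in> ?R"
      using ab
      by (elim insertE emptyE)
         (drule determined, rule rotations, simp add: dist dist[symmetric], simp)+
  qed
  show "?R \<subseteq> ?L"
    using assms dist dist[symmetric]
    by (simp add: labelled_cycles5_def closed_walks5_def cycle_of_def insert_commute)
qed

text \<open>Applied with \<open>m = 10\<close> to the labellings of a cycle and with
  \<open>m = 2\<close> to the orientations of an edge.\<close>

lemma card_eq_mult_card_image:
  assumes "finite A" "\<And>x. x \<in> A \<Longrightarrow> card {y \<in> A. f y = f x} = m"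
  shows "card A = m * card (f ` A)"
proof -
  have "card A = (\<Sum>y\<in>f ` A. card {x \<in> A. f x = y})"
    using sum.image_gen[OF assms(1), of "\<lambda>_. 1::nat" f] by simp
  also have "\<dots> = (\<Sum>y\<in>f ` A. m)"
    using assms(2) by (intro sum.cong) auto
  finally show ?thesis by simp
qed

section \<open>Closed walks against labelled cycles\<close>

lemma finite_closed_walks5:
  assumes "simple_graph G"
  shows "finite (closed_walks5 G)"
proof (rule finite_subset)
  show "closed_walks5 G \<subseteq> verts G \<times> verts G \<times> verts G \<times> verts G \<times> verts G"
    by (auto simp: closed_walks5_def)
qed (use assms in \<open>auto simp: simple_graph_def\<close>)

lemma card_labelled_cycles5:
  assumes "simple_graph G"
  shows "card (labelled_cycles5 G) = 10 * copies (cycle_graph 5) G"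
  unfolding copies_def subgraph_cycle5_image[OF assms]
proof (rule card_eq_mult_card_image)
  show "finite (labelled_cycles5 G)"
    using finite_closed_walks5[OF assms] by (rule rev_finite_subset) (auto simp: labelled_cycles5_def)
  fix t assume t: "t \<in> labelled_cycles5 G"
  obtain a b c d e where [simp]: "t = (a, b, c, d, e)" by (cases t)
  have "distinct [a, b, c, d, e]" using t by (simp add: labelled_cycles5_def)
  then show "card {s \<in> labelled_cycles5 G. cycle_of s = cycle_of t} = 10"
    using t by (simp add: cycle_of_fibre)
qed

text \<open>Adjacent entries of a closed walk differ, so a non-injective one identifies two of the
  five non-adjacent pairs.\<close>

lemma card_closed_walks5_le:
  assumes "simple_graph G"
  shows "card (closed_walks5 G) \<le> card (labelled_cycles5 G) + 5 * card (verts G) ^ 4"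
proof -
  let ?V = "verts G" and ?Q = "verts G \<times> verts G \<times> verts G \<times> verts G"
  have fin: "finite ?V" using assms by (simp add: simple_graph_def)
  have ne: "x \<noteq> y" if "{x, y} \<in> edges G" for x y
    using assms that by (force simp: simple_graph_def)
  \<comment> \<open>Restores the repeated vertex: \<open>h 0\<close> to \<open>h 4\<close> cover the
    coincidences \<open>a = c\<close>, \<open>a = d\<close>, \<open>b = d\<close>,
    \<open>b = e\<close>, \<open>c = e\<close>. Each image has at most \<open>card ?V ^ 4\<close>
    elements.\<close>
  define h :: "nat \<Rightarrow> 'a \<times> 'a \<times> 'a \<times> 'a \<Rightarrow> 'a \<times> 'a \<times> 'a \<times> 'a \<times> 'a" where
    "h i = (\<lambda>(x, y, z, w). if i = 0 then (x, y, x, z, w) else if i = 1 then (x, y, z, x, w)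
       else if i = 2 then (x, y, z, y, w) else if i = 3 then (x, y, z, w, y) else (x, y, z, w, z))" for i
  have "closed_walks5 G \<subseteq> labelled_cycles5 G \<union> (\<Union>i<5. h i ` ?Q)"
  proof
    fix t assume t: "t \<in> closed_walks5 G"
    obtain a b c d e where [simp]: "t = (a, b, c, d, e)" by (cases t)
    have V: "a \<in> ?V" "b \<in> ?V" "c \<in> ?V" "d \<in> ?V" "e \<in> ?V"
      and adj: "a \<noteq> b" "b \<noteq> c" "c \<noteq> d" "d \<noteq> e" "e \<noteq> a"
      using t ne by (auto simp: closed_walks5_def)
    consider "distinct [a, b, c, d, e]" | "a = c" | "a = d" | "b = d" | "b = e" | "c = e"
      using adj by auto
    then show "t \<in> labelled_cycles5 G \<union> (\<Union>i<5. h i ` ?Q)"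
    proof cases
      case 1 then show ?thesis using t by (simp add: labelled_cycles5_def)
    next
      case 2 then have "t = h 0 (a, b, d, e)" by (simp add: h_def)
      then show ?thesis using V by (intro UnI2 UN_I[of 0]) auto
    next
      case 3 then have "t = h 1 (a, b, c, e)" by (simp add: h_def)
      then show ?thesis using V by (intro UnI2 UN_I[of 1]) auto
    next
      case 4 then have "t = h 2 (a, b, c, e)" by (simp add: h_def)
      then show ?thesis using V by (intro UnI2 UN_I[of 2]) auto
    next
      case 5 then have "t = h 3 (a, b, c, d)" by (simp add: h_def)
      then show ?thesis using V by (intro UnI2 UN_I[of 3]) auto
    next
      case 6 then have "t = h 4 (a, b, c, d)" by (simp add: h_def)
      then show ?thesis using V by (intro UnI2 UN_I[of 4]) auto
    qed
  qed
  moreover have "finite (labelled_cycles5 G)"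
    using finite_closed_walks5[OF assms] by (rule rev_finite_subset) (auto simp: labelled_cycles5_def)
  ultimately have "card (closed_walks5 G) \<le> card (labelled_cycles5 G \<union> (\<Union>i<5. h i ` ?Q))"
    using fin by (intro card_mono) auto
  also have "\<dots> \<le> card (labelled_cycles5 G) + card (\<Union>i<5. h i ` ?Q)"
    by (rule card_Un_le)
  also have "card (\<Union>i<5. h i ` ?Q) \<le> (\<Sum>i<5. card (h i ` ?Q))"
    by (rule card_UN_le) simp
  also have "\<dots> \<le> (\<Sum>i<(5::nat). card ?Q)"
    using fin by (intro sum_mono card_image_le) simp
  also have "\<dots> = 5 * card ?V ^ 4"
    by (simp add: card_cartesian_product eval_nat_numeral)
  finally show ?thesis by simp
qed

section \<open>From graphs to kernels\<close>

text \<open>As \<open>{x, x}\<close> is a singleton, it is no edge of a simple graph, so the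
  diagonal entries are 1 and \<open>1 - nonadj G\<close> is the adjacency matrix.\<close>

definition nonadj :: "'a ugraph \<Rightarrow> 'a \<Rightarrow> 'a \<Rightarrow> real" where
  "nonadj G x y = of_bool ({x, y} \<notin> edges G)"

lemma symmetric_kernel_nonadj: "symmetric_kernel (nonadj G)"
  by unfold_locales (simp add: nonadj_def insert_commute)

lemma card_closed_walks5:
  assumes "simple_graph G"
  shows "real (card (closed_walks5 G)) = symmetric_kernel.complement_closed5 (verts G) (nonadj G)"
proof -
  interpret symmetric_kernel "verts G" "nonadj G" by (rule symmetric_kernel_nonadj)
  let ?V = "verts G"
  define W where "W x y = 1 - nonadj G x y" for x y
  have fin: "finite ?V" using assms by (simp add: simple_graph_def)
  have W: "W x y = of_bool ({x, y} \<in> edges G)" for x y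
    by (simp add: W_def nonadj_def)
  have "real (card (closed_walks5 G)) = (\<Sum>t\<in>?V \<times> ?V \<times> ?V \<times> ?V \<times> ?V. of_bool (t \<in> closed_walks5 G))"
  proof -
    have "closed_walks5 G = {t \<in> ?V \<times> ?V \<times> ?V \<times> ?V \<times> ?V. t \<in> closed_walks5 G}"
      by (auto simp: closed_walks5_def)
    then show ?thesis using fin by (simp add: Int_def)
  qed
  also have "\<dots> = (\<Sum>(a, b, c, d, e)\<in>?V \<times> ?V \<times> ?V \<times> ?V \<times> ?V. W a b * W b c * W c d * W d e * W e a)"
    by (rule sum.cong) (auto simp: W closed_walks5_def)
  also have "\<dots> = (\<Sum>a\<in>?V. \<Sum>b\<in>?V. \<Sum>c\<in>?V. \<Sum>d\<in>?V. \<Sum>e\<in>?V. W a b * W b c * W c d * W d e * W e a)"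
    by (simp add: sum.cartesian_product)
  \<comment> \<open>The nesting of \<open>complement_closed5\<close>: \<open>a\<close> and
    \<open>c\<close> cut the cycle into two arcs, \<open>b\<close> is the midpoint of the short one,
    and the two-walk from \<open>c\<close> through \<open>d\<close> to \<open>e\<close> sits inside
    the sum over \<open>e\<close>.\<close>
  also have "\<dots> = (\<Sum>a\<in>?V. \<Sum>c\<in>?V. \<Sum>b\<in>?V. \<Sum>e\<in>?V. \<Sum>d\<in>?V. W a b * W b c * W c d * W d e * W e a)"
    by (subst (2) sum.swap, subst (4) sum.swap) simp
  also have "\<dots> = complement_closed5"
    unfolding complement_closed5_def W_def[symmetric] sum_product
    by (simp add: sum_distrib_left sum_distrib_right mult.assoc)
  finally show ?thesis .
qed

text \<open>All ordered pairs count except the adjacent ones, of which each edge gives two. This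
  ties the density of the kernel to the number of edges.\<close>

lemma sum_nonadj:
  assumes "simple_graph G"
  shows "symmetric_kernel.walks1 (verts G) (nonadj G) = (real (card (verts G)))\<^sup>2 - 2 * real (card (edges G))"
proof -
  interpret symmetric_kernel "verts G" "nonadj G" by (rule symmetric_kernel_nonadj)
  let ?V = "verts G"
  let ?P = "{(x, y). {x, y} \<in> edges G}"
  have fin: "finite ?V" using assms by (simp add: simple_graph_def)
  have edge: "x \<in> ?V \<and> y \<in> ?V \<and> x \<noteq> y" if "{x, y} \<in> edges G" for x y
    using assms that by (force simp: simple_graph_def)
  have P: "?P \<subseteq> ?V \<times> ?V" using edge by auto
  have finP: "finite ?P" by (rule finite_subset[OF P]) (simp add: fin)
  have "(\<lambda>(x, y). {x, y}) ` ?P = edges G"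
  proof
    show "edges G \<subseteq> (\<lambda>(x, y). {x, y}) ` ?P"
    proof
      fix f assume f: "f \<in> edges G"
      then obtain x y where "f = {x, y}"
        using assms by (auto simp: simple_graph_def card_2_iff)
      then show "f \<in> (\<lambda>(x, y). {x, y}) ` ?P" using f by force
    qed
  qed auto
  moreover have "card ?P = 2 * card ((\<lambda>(x, y). {x, y}) ` ?P)"
  proof (rule card_eq_mult_card_image[OF finP])
    fix t assume "t \<in> ?P"
    then obtain x y where t: "t = (x, y)" "{x, y} \<in> edges G" by auto
    then have "{y, x} \<in> edges G" by (simp add: insert_commute)
    have "{s \<in> ?P. (\<lambda>(x, y). {x, y}) s = (\<lambda>(x, y). {x, y}) t} = {(x, y), (y, x)}"
    proof (rule set_eqI)
      fix s :: "'a \<times> 'a"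
      obtain u v where s: "s = (u, v)" by (cases s)
      show "s \<in> {s \<in> ?P. (\<lambda>(x, y). {x, y}) s = (\<lambda>(x, y). {x, y}) t} \<longleftrightarrow> s \<in> {(x, y), (y, x)}"
        using t(2) \<open>{y, x} \<in> edges G\<close> unfolding s t(1) by (simp add: doubleton_eq_iff) blast
    qed
    then show "card {s \<in> ?P. (\<lambda>(x, y). {x, y}) s = (\<lambda>(x, y). {x, y}) t} = 2"
      using edge[OF t(2)] by simp
  qed
  ultimately have "card ?P = 2 * card (edges G)" by simp
  moreover have "walks1 = (\<Sum>t\<in>?V \<times> ?V. 1 - of_bool (t \<in> ?P))"
    unfolding walks1_def deg_def sum.cartesian_product
    by (rule sum.cong) (auto simp: nonadj_def)
  moreover have "(\<Sum>t\<in>?V \<times> ?V. of_bool (t \<in> ?P)) = real (card ?P)"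
    using fin P by (simp add: Int_absorb1 flip: Int_def) 
  ultimately show ?thesis
    by (simp add: sum_subtractf card_cartesian_product power2_eq_square)
qed

section \<open>Turan graphs and the limit\<close>

text \<open>The parameter \<open>n\<close> is the size of a part, not the order. The parts are
  residue classes modulo \<open>k\<close>, so they are exactly balanced.\<close>

definition turan_graph :: "nat \<Rightarrow> nat \<Rightarrow> nat ugraph" where
  "turan_graph k n =
    ({..<n * k}, {{u, v} | u v. u < n * k \<and> v < n * k \<and> u mod k \<noteq> v mod k})"

lemma edges_turan_graph_iff:
  "{u, v} \<in> edges (turan_graph k n) \<longleftrightarrow> u < n * k \<and> v < n * k \<and> u mod k \<noteq> v mod k"
  by (auto simp: turan_graph_def doubleton_eq_iff)

lemma verts_turan_graph: "verts (turan_graph k n) = {..<n * k}"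
  by (simp add: turan_graph_def)

lemma simple_turan_graph: "simple_graph (turan_graph k n)"
  by (auto simp: turan_graph_def simple_graph_def card_2_iff)

lemma card_residue_class:
  fixes k n r :: nat
  assumes "r < k"
  shows "card {y. y < n * k \<and> y mod k = r} = n"
proof -
  have "{y. y < n * k \<and> y mod k = r} = (\<lambda>i. i * k + r) ` {..<n}"
  proof (intro set_eqI iffI)
    fix y assume y: "y \<in> {y. y < n * k \<and> y mod k = r}"
    then have "y = (y div k) * k + r" "y div k < n"
      using assms by (auto simp: less_mult_imp_div_less)
    then show "y \<in> (\<lambda>i. i * k + r) ` {..<n}" by blast
  next
    fix y assume "y \<in> (\<lambda>i. i * k + r) ` {..<n}"
    then obtain i where i: "y = i * k + r" "i < n" by auto
    have "y < Suc i * k" using i assms by simp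
    also have "\<dots> \<le> n * k" using i by (intro mult_le_mono1) simp
    finally show "y \<in> {y. y < n * k \<and> y mod k = r}" using i assms by simp
  qed
  moreover have "inj_on (\<lambda>i. i * k + r) {..<n}"
    using assms by (auto simp: inj_on_def)
  ultimately show ?thesis by (simp add: card_image)
qed

text \<open>Non-adjacency is congruence modulo \<open>k\<close>, an equivalence relation with
  classes of size \<open>n\<close>; hence the regular case applies with \<open>D = n\<close> and
  \<open>N = n * k\<close>.\<close>

lemma
  fixes k n :: nat
  assumes "k > 0"
  shows turan_graph_closed_walks5: "real (card (closed_walks5 (turan_graph k n))) =
      real n ^ 5 * (real k ^ 5 - 5 * real k ^ 4 + 10 * real k ^ 3 - 10 * (real k)\<^sup>2 + 4 * real k)"
    and turan_graph_edges: "2 * real (card (edges (turan_graph k n))) = (real n)\<^sup>2 * (real k)\<^sup>2 - (real n)\<^sup>2 * real k"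
proof -
  let ?G = "turan_graph k n"
  interpret symmetric_kernel "verts ?G" "nonadj ?G" by (rule symmetric_kernel_nonadj)
  have nonadj: "nonadj ?G x y = of_bool (x mod k = y mod k)" if "x \<in> verts ?G" "y \<in> verts ?G" for x y
    using that by (auto simp: nonadj_def edges_turan_graph_iff verts_turan_graph)
  have deg: "deg x = real n" if "x \<in> verts ?G" for x
  proof -
    have "deg x = (\<Sum>y\<in>verts ?G. of_bool (y mod k = x mod k))"
      unfolding deg_def using that by (intro sum.cong) (auto simp: nonadj)
    also have "\<dots> = real (card {y. y < n * k \<and> y mod k = x mod k})"
      by (simp add: verts_turan_graph Int_def)
    finally show ?thesis using card_residue_class[of "x mod k" k n] assms by simp
  qed
  have B2: "B2 x y = real n * nonadj ?G x y" if "x \<in> verts ?G" "y \<in> verts ?G" for x y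
  proof -
    \<comment> \<open>By transitivity, \<open>z\<close> is congruent to both \<open>x\<close> and
      \<open>y\<close> exactly when \<open>x\<close> and \<open>y\<close> are congruent and
      \<open>z\<close> is congruent to \<open>x\<close>.\<close>
    have "B2 x y = (\<Sum>z\<in>verts ?G. nonadj ?G x y * nonadj ?G x z)"
      unfolding B2_def using that by (intro sum.cong) (auto simp: nonadj)
    then show ?thesis
      using deg[OF that(1)] by (simp add: sum_distrib_left[symmetric] deg_def)
  qed
  have N: "N = real n * real k" by (simp add: N_def, simp add: verts_turan_graph)
  have "real (card (closed_walks5 ?G)) = N ^ 5 - 5 * N ^ 4 * real n + 10 * N ^ 3 * (real n)\<^sup>2
      - 10 * N\<^sup>2 * real n ^ 3 + 4 * N * real n ^ 4"
    unfolding card_closed_walks5[OF simple_turan_graph]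
    by (rule complement_closed5_regular[OF deg B2]) (simp_all add: nonadj_def)
  then show "real (card (closed_walks5 ?G)) =
      real n ^ 5 * (real k ^ 5 - 5 * real k ^ 4 + 10 * real k ^ 3 - 10 * (real k)\<^sup>2 + 4 * real k)"
    unfolding N by (simp add: algebra_simps power_mult_distrib eval_nat_numeral)
  have "walks1 = N * real n" using deg by (simp add: walks1_def N_def)
  then show "2 * real (card (edges ?G)) = (real n)\<^sup>2 * (real k)\<^sup>2 - (real n)\<^sup>2 * real k"
    using sum_nonadj[OF simple_turan_graph, of k n] unfolding N
    by (simp add: verts_turan_graph power2_eq_square algebra_simps)
qed

section \<open>Densities of Turan graphs\<close>

lemma card_verts_cycle_graph: "card (verts (cycle_graph m)) = m"
  by (simp add: cycle_graph_def)

lemma real_choose_two: "real (m choose 2) = real m * (real m - 1) / 2"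
proof (cases m)
  case (Suc j)
  have "even (m * (m - 1))" by (cases "even m") auto
  then have "real (m choose 2) = real (m * (m - 1)) / 2"
    by (simp add: choose_two real_of_nat_div)
  then show ?thesis using Suc by (simp add: algebra_simps)
qed simp

text \<open>For an upper bound it suffices that labelled cycles are closed walks, so there is no
  error term.\<close>

lemma copy_density_turan_graph_le:
  assumes "k > 0" "n > 0"
  shows "copy_density (cycle_graph 5) (turan_graph k n) \<le>
    1 / 10 - 1 / (2 * real k) + 1 / real k ^ 2 - 1 / real k ^ 3 + 2 / (5 * real k ^ 4)"
proof -
  let ?G = "turan_graph k n"
  have "labelled_cycles5 ?G \<subseteq> closed_walks5 ?G" by (auto simp: labelled_cycles5_def)
  then have "card (labelled_cycles5 ?G) \<le> card (closed_walks5 ?G)"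
    by (intro card_mono finite_closed_walks5 simple_turan_graph)
  then have "10 * real (copies (cycle_graph 5) ?G) \<le> real (card (closed_walks5 ?G))"
    unfolding card_labelled_cycles5[OF simple_turan_graph] by linarith
  then have "real (copies (cycle_graph 5) ?G) \<le>
      real n ^ 5 * (real k ^ 5 - 5 * real k ^ 4 + 10 * real k ^ 3 - 10 * (real k)\<^sup>2 + 4 * real k) / 10"
    unfolding turan_graph_closed_walks5[OF assms(1)] by simp
  then have "copy_density (cycle_graph 5) ?G \<le>
      real n ^ 5 * (real k ^ 5 - 5 * real k ^ 4 + 10 * real k ^ 3 - 10 * (real k)\<^sup>2 + 4 * real k) / 10
      / (real n * real k) ^ 5"
    unfolding copy_density_def card_verts_cycle_graph verts_turan_graph card_lessThan of_nat_mult
    by (rule divide_right_mono) simp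
  also have "\<dots> = 1 / 10 - 1 / (2 * real k) + 1 / real k ^ 2 - 1 / real k ^ 3 + 2 / (5 * real k ^ 4)"
    using assms by (simp add: field_simps eval_nat_numeral)
  finally show ?thesis .
qed

lemma edge_density_turan_graph:
  assumes "k > 0" "n > 0"
  shows "edge_density (turan_graph k n) = (real k - 1) / (real k - 1 / real n)"
proof -
  have "edge_density (turan_graph k n) =
      ((real n * real k) * (real n * (real k - 1))) / ((real n * real k) * (real n * real k - 1))"
    unfolding edge_density_def real_choose_two
    using turan_graph_edges[OF assms(1), of n]
    by (simp add: verts_turan_graph power2_eq_square algebra_simps)
  also have "\<dots> = (real n * (real k - 1)) / (real n * (real k - 1 / real n))"
    using assms by (subst mult_divide_mult_cancel_left) (simp_all add: algebra_simps)
  finally show ?thesis using assms by simp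
qed

lemma edge_density_turan_graph_tendsto:
  assumes "k > 0"
  shows "(\<lambda>n. edge_density (turan_graph k (Suc n))) \<longlonglongrightarrow> 1 - 1 / real k"
proof -
  have "(\<lambda>n. (real k - 1) / (real k - 1 / real (Suc n))) \<longlonglongrightarrow> (real k - 1) / (real k - 0)"
    using assms
    by (intro tendsto_intros LIMSEQ_Suc[OF lim_1_over_n]) auto
  then show ?thesis
    using assms by (simp add: edge_density_turan_graph diff_divide_distrib)
qed

section \<open>The lower bound along arbitrary graph sequences\<close>

text \<open>Here \<open>b\<close> is the density of the complement with loops. The error term is the
  bound of \<open>5 * m^4\<close> non-injective walks divided by \<open>10 * m^5\<close>, where
  \<open>m\<close> is the order.\<close>

lemma copy_density_cycle5_ge:
  assumes G: "simple_graph G" and "card (verts G) > 0"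
    and b: "b = 1 - 2 * real (card (edges G)) / (real (card (verts G)))\<^sup>2"
  shows "copy_density (cycle_graph 5) G \<ge>
    (1 - 5 * b + 10 * b\<^sup>2 - 10 * b ^ 3 + 4 * b ^ 4) / 10 - 1 / (2 * real (card (verts G)))"
proof -
  let ?m = "real (card (verts G))"
  interpret symmetric_kernel "verts G" "nonadj G" by (rule symmetric_kernel_nonadj)
  have N: "N = ?m" by (simp add: N_def)
  have m: "?m > 0" using assms(2) by simp
  have "b = walks1 / N\<^sup>2"
    using m unfolding b N sum_nonadj[OF G] by (simp add: diff_divide_distrib)
  then have "complement_closed5 \<ge> (1 - 5 * b + 10 * b\<^sup>2 - 10 * b ^ 3 + 4 * b ^ 4) * N ^ 5"
    using m by (intro complement_closed5_ge) (simp_all add: nonadj_def N)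
  moreover have "real (card (closed_walks5 G)) \<le> real (10 * copies (cycle_graph 5) G + 5 * card (verts G) ^ 4)"
    using card_closed_walks5_le[OF G] unfolding card_labelled_cycles5[OF G] by (rule of_nat_mono)
  ultimately have "(1 - 5 * b + 10 * b\<^sup>2 - 10 * b ^ 3 + 4 * b ^ 4) * ?m ^ 5 \<le>
      10 * real (copies (cycle_graph 5) G) + 5 * ?m ^ 4"
    unfolding card_closed_walks5[OF G] N by simp
  then have "((1 - 5 * b + 10 * b\<^sup>2 - 10 * b ^ 3 + 4 * b ^ 4) * ?m ^ 5 - 5 * ?m ^ 4) / 10 / ?m ^ 5 \<le>
      copy_density (cycle_graph 5) G"
    unfolding copy_density_def card_verts_cycle_graph using m by (intro divide_right_mono) simp_all
  moreover have "((1 - 5 * b + 10 * b\<^sup>2 - 10 * b ^ 3 + 4 * b ^ 4) * ?m ^ 5 - 5 * ?m ^ 4) / 10 / ?m ^ 5 =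
      (1 - 5 * b + 10 * b\<^sup>2 - 10 * b ^ 3 + 4 * b ^ 4) / 10 - 1 / (2 * ?m)"
    using m unfolding diff_divide_distrib by (simp add: eval_nat_numeral)
  ultimately show ?thesis by simp
qed

lemma liminf_copy_density_cycle5_ge:
  fixes G :: "nat \<Rightarrow> 'a ugraph"
  assumes G: "\<And>n. simple_graph (G n)"
    and inf: "filterlim (\<lambda>n. card (verts (G n))) at_top sequentially"
    and dens: "(\<lambda>n. edge_density (G n)) \<longlonglongrightarrow> 1 - q"
  shows "liminf (\<lambda>n. ereal (copy_density (cycle_graph 5) (G n))) \<ge>
    ereal ((1 - 5 * q + 10 * q\<^sup>2 - 10 * q ^ 3 + 4 * q ^ 4) / 10)"
proof -
  define m where "m n = real (card (verts (G n)))" for n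
  define b where "b n = 1 - 2 * real (card (edges (G n))) / (m n)\<^sup>2" for n
  have m_inf: "filterlim m at_top sequentially"
    unfolding m_def by (rule filterlim_compose[OF filterlim_real_sequentially inf])
  have inv: "(\<lambda>n. inverse (m n)) \<longlonglongrightarrow> 0"
    by (rule tendsto_inverse_0_at_top[OF m_inf])
  have large: "\<forall>\<^sub>F n in sequentially. m n > 1"
    using m_inf by (simp add: filterlim_at_top_dense)
  \<comment> \<open>The factor \<open>1 - 1/m\<close> converts the normalisation by
    \<open>m choose 2\<close> into the one by \<open>m^2 / 2\<close> used in
    \<open>b\<close>.\<close>
  have "(\<lambda>n. 1 - edge_density (G n) * (1 - inverse (m n))) \<longlonglongrightarrow> 1 - (1 - q) * (1 - 0)"
    by (intro tendsto_intros dens inv)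
  moreover have "\<forall>\<^sub>F n in sequentially. 1 - edge_density (G n) * (1 - inverse (m n)) = b n"
    using large
  proof eventually_elim
    case (elim n)
    then show ?case
      unfolding edge_density_def real_choose_two b_def m_def[symmetric]
      by (simp add: field_simps power2_eq_square)
  qed
  ultimately have b: "b \<longlonglongrightarrow> q"
    by (simp add: tendsto_cong)
  define r where "r n = (1 - 5 * b n + 10 * (b n)\<^sup>2 - 10 * b n ^ 3 + 4 * b n ^ 4) / 10 - inverse (m n) / 2" for n
  have "r \<longlonglongrightarrow> (1 - 5 * q + 10 * q\<^sup>2 - 10 * q ^ 3 + 4 * q ^ 4) / 10 - 0 / 2"
    unfolding r_def by (intro tendsto_intros b inv) simp_all
  then have "(\<lambda>n. ereal (r n)) \<longlonglongrightarrow> ereal ((1 - 5 * q + 10 * q\<^sup>2 - 10 * q ^ 3 + 4 * q ^ 4) / 10)"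
    by simp
  then have "ereal ((1 - 5 * q + 10 * q\<^sup>2 - 10 * q ^ 3 + 4 * q ^ 4) / 10) = liminf (\<lambda>n. ereal (r n))"
    by (intro lim_imp_Liminf[symmetric]) simp_all
  also have "\<dots> \<le> liminf (\<lambda>n. ereal (copy_density (cycle_graph 5) (G n)))"
  proof (rule Liminf_mono)
    show "\<forall>\<^sub>F n in sequentially. ereal (r n) \<le> ereal (copy_density (cycle_graph 5) (G n))"
      using large
    proof eventually_elim
      case (elim n)
      then have "card (verts (G n)) > 0" by (auto simp: m_def)
      then show ?case
        using copy_density_cycle5_ge[OF G _ b_def[of n, unfolded m_def]]
        by (simp add: r_def m_def field_simps)
    qed
  qed
  finally show ?thesis .
qed

theorem theorem1:
  fixes k :: nat and p lambda :: real
  assumes "k \<ge> 3"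
    and "p = 1 - 1 / real k"
    and "lambda = 1 / 10 - 1 / (2 * real k) + 1 / real k ^ 2 - 1 / real k ^ 3 + 2 / (5 * real k ^ 4)"
  shows "min_copy_density (cycle_graph 5) p = ereal lambda"
proof (rule antisym)
  have k: "k > 0" using assms(1) by simp
  \<comment> \<open>The shift by \<open>Suc\<close> avoids the empty graph, since the density
    formulas need parts of positive size.\<close>
  let ?T = "\<lambda>n. turan_graph k (Suc n)"
  have "filterlim (\<lambda>n. card (verts (?T n))) at_top sequentially"
  proof (rule filterlim_at_top_mono[OF filterlim_ident])
    show "\<forall>\<^sub>F n in sequentially. n \<le> card (verts (?T n))"
    proof (rule always_eventually, rule allI)
      fix n :: nat
      have "n \<le> Suc n * 1" by simp
      also have "\<dots> \<le> Suc n * k" using k by (intro mult_le_mono2) simp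
      finally show "n \<le> card (verts (?T n))" by (simp add: verts_turan_graph)
    qed
  qed
  then have "min_copy_density (cycle_graph 5) p \<le>
      liminf (\<lambda>n. ereal (copy_density (cycle_graph 5) (?T n)))"
    unfolding min_copy_density_def assms(2)
    using simple_turan_graph edge_density_turan_graph_tendsto[OF k]
    by (intro Inf_lower CollectI exI[of _ ?T]) simp
  also have "\<dots> \<le> liminf (\<lambda>n. ereal lambda)"
    using copy_density_turan_graph_le[OF k] unfolding assms(3)
    by (intro Liminf_mono always_eventually) simp
  also have "\<dots> = ereal lambda" by (simp add: Liminf_const)
  finally show "min_copy_density (cycle_graph 5) p \<le> ereal lambda" .
next
  \<comment> \<open>A tenth of the lower-bound polynomial at \<open>q = 1 / k\<close>, which is the
    limiting density of the complement when the edge density tends to \<open>p\<close>.\<close>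
  have lambda: "lambda = (1 - 5 * (1 / real k) + 10 * (1 / real k)\<^sup>2 - 10 * (1 / real k) ^ 3
      + 4 * (1 / real k) ^ 4) / 10"
    unfolding assms(3) by (simp add: field_simps)
  show "ereal lambda \<le> min_copy_density (cycle_graph 5) p"
    unfolding min_copy_density_def lambda assms(2)
    using liminf_copy_density_cycle5_ge by (intro Inf_greatest) blast
qed

end
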